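(* Let $G$ be a Lie group and let $d:G\times G\to\mathbb R$ be a metric on $G$ such that $\tau_d=\tau_G$. Let $X=\{x_1,\ldots,x_k\}\ni e$ be a finite subset of $G$ such that $H_X=\{e\}$, and let $d,d^1,d^2,\ldots$ be the sequence of induced Hausdorff metrics on $G$ associated with $X$ (for the action of $G$ on itself by left multiplication). Suppose that $d$ is bounded above by a right invariant intrinsic metric $\mathbf d$ on $G$ (which implies that $G$ is connected). Then every $d^i$ is bounded above by $\mathbf d$, and the sequence of induced Hausdorff metrics converges pointwise to a metric $d^\infty$ on $G$.
   Context: Notation. "Metric" means distance function; an extended metric may take the value $\infty$. $\tau_\rho$ is the topology induced by $\rho$ and $\tau_G$ is the manifold topology of $G$; $e$ is the identity. $\rho$ is right invariant if $\rho(x\sigma,y\sigma)=\rho(x,y)$ for all $x,y,\sigma\in G$. "Bounded above by $\mathbf d$" means $\le\mathbf d$ on $G\times G$. Lengths and intrinsic metrics. For a path $\gamma:[a,b]\to M$ in an (extended) metric space $(M,\rho)$, $\ell_\rho(\gamma)=\sup\sum_i\rho(\gamma(t_i),\gamma(t_{i-1}))$ over all partitions of $[a,b]$. The intrinsic (extended) metric induced by $\rho$ is $\hat\rho(x,y)=\inf_\gamma\ell_\rho(\gamma)$ over all continuous paths in $(M,\rho)$ connecting $x$ and $y$ ($\inf\emptyset=\infty$). $\rho$ is intrinsic if $\hat\rho=\rho$. Sequence of induced Hausdorff metrics. For a finite $X\subset G$ put $gX=\{gx:x\in X\}$ and $H_X=\{g\in G: gX=X\}$. For an (extended) metric $\rho$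 on $G$, let $\rho_H(A,B)=\max\{\max_{a\in A}\min_{b\in B}\rho(a,b),\max_{b\in B}\min_{a\in A}\rho(a,b)\}$ for finite nonempty $A,B$. If $H_X=\{e\}$, then $\rho_X(g,h):=\rho_H(gX,hX)$ is an (extended) metric on $G$. The sequence of induced Hausdorff metrics is $d^0=d$, $d^{i}=\widehat{(d^{i-1})_X}$ for $i\ge1$. *)

theory Defs
  imports "HOL-Analysis.Analysis" "HOL-Algebra.Coset"
begin

section \<open>Lie groups\<close>

text \<open>
  The model space of dimension \<open>n\<close> is \<^term>\<open>Euclidean_space n\<close>, whose points are the functions
  \<open>nat \<Rightarrow> real\<close> vanishing at all indices \<open>\<ge> n\<close>; in particular \<open>n = 0\<close> is allowed.
\<close>

text \<open>\<open>Ck_on n k U f\<close>: all partial derivatives of \<open>f\<close> of order at most \<open>k\<close> exist and are continuous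
  on \<open>U\<close>.  It is only used for \<open>U\<close> open in \<^term>\<open>Euclidean_space n\<close>, so that for \<open>i < n\<close> the points
  \<open>x(i := t)\<close> lie in \<open>U\<close> for all \<open>t\<close> near \<open>x i\<close>.\<close>

primrec Ck_on :: "nat \<Rightarrow> nat \<Rightarrow> (nat \<Rightarrow> real) set \<Rightarrow> ((nat \<Rightarrow> real) \<Rightarrow> real) \<Rightarrow> bool" where
  "Ck_on n 0 U f \<longleftrightarrow> continuous_map (subtopology (Euclidean_space n) U) euclideanreal f"
| "Ck_on n (Suc k) U f \<longleftrightarrow>
     continuous_map (subtopology (Euclidean_space n) U) euclideanreal f \<and>
     (\<forall>i<n. \<exists>f'. (\<forall>x\<in>U. ((\<lambda>t. f (x(i := t))) has_real_derivative f' x) (at (x i))) \<and>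
                 Ck_on n k U f')"

definition smooth_on_Euclidean ::
    "nat \<Rightarrow> nat \<Rightarrow> (nat \<Rightarrow> real) set \<Rightarrow> ((nat \<Rightarrow> real) \<Rightarrow> (nat \<Rightarrow> real)) \<Rightarrow> bool" where
  "smooth_on_Euclidean n m U f \<longleftrightarrow> (\<forall>j<m. \<forall>k. Ck_on n k U (\<lambda>x. f x j))"

text \<open>A chart is a pair \<open>(U, \<phi>)\<close>; only the values of \<open>\<phi>\<close> on \<open>U\<close> matter.\<close>

type_synonym 'a chart = "'a set \<times> ('a \<Rightarrow> nat \<Rightarrow> real)"

definition is_chart :: "nat \<Rightarrow> 'a topology \<Rightarrow> 'a chart \<Rightarrow> bool" where
  "is_chart n T = (\<lambda>(U, \<phi>). openin T U \<and> openin (Euclidean_space n) (\<phi> ` U) \<and>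
     homeomorphic_map (subtopology T U) (subtopology (Euclidean_space n) (\<phi> ` U)) \<phi>)"

locale smooth_manifold =
  fixes n :: nat and T :: "'a topology" and A :: "'a chart set"
  assumes Hausdorff: "Hausdorff_space T"
    and second_countable: "second_countable T"
    and charts: "c \<in> A \<Longrightarrow> is_chart n T c"
    and covering: "(\<Union>(U, \<phi>)\<in>A. U) = topspace T"
    and transition: "\<lbrakk>(U, \<phi>) \<in> A; (V, \<psi>) \<in> A\<rbrakk> \<Longrightarrow>
          smooth_on_Euclidean n n (\<phi> ` (U \<inter> V)) (\<psi> \<circ> inv_into U \<phi>)"

definition smooth_map ::
    "nat \<Rightarrow> 'a topology \<Rightarrow> 'a chart set \<Rightarrow> nat \<Rightarrow> 'b topology \<Rightarrow> 'b chart set \<Rightarrow> ('a \<Rightarrow> 'b) \<Rightarrow> bool" where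
  "smooth_map n T A m S B f \<longleftrightarrow> continuous_map T S f \<and>
     (\<forall>(U, \<phi>)\<in>A. \<forall>(V, \<psi>)\<in>B.
        smooth_on_Euclidean n m (\<phi> ` {x \<in> U. f x \<in> V}) (\<psi> \<circ> f \<circ> inv_into U \<phi>))"

text \<open>The atlas of a product manifold: a pair of points of the model spaces of dimensions \<open>n\<close> and \<open>m\<close>
  is concatenated to a point of the model space of dimension \<open>n + m\<close>.\<close>

definition prod_atlas :: "nat \<Rightarrow> 'a chart set \<Rightarrow> 'b chart set \<Rightarrow> ('a \<times> 'b) chart set" where
  "prod_atlas n A B =
     {(U \<times> V, \<lambda>(x, y) i. if i < n then \<phi> x i else \<psi> y (i - n)) | U \<phi> V \<psi>.
        (U, \<phi>) \<in> A \<and> (V, \<psi>) \<in> B}"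

locale lie_group = group G + smooth_manifold n T A
  for G (structure) and n :: nat and T :: "'a topology" and A :: "'a chart set" +
  assumes topspace_eq: "topspace T = carrier G"
    and smooth_mult:
      "smooth_map (n + n) (prod_topology T T) (prod_atlas n A A) n T A (\<lambda>(x, y). x \<otimes> y)"
    and smooth_inv: "smooth_map n T A n T A (\<lambda>x. inv x)"


section \<open>Extended metrics, lengths and intrinsic metrics\<close>

text \<open>Extended metrics on \<open>M\<close> are represented by functions into \<^typ>\<open>ennreal\<close>, of which only the
  values on \<open>M \<times> M\<close> matter.\<close>

definition emetric_topology :: "'a set \<Rightarrow> ('a \<Rightarrow> 'a \<Rightarrow> ennreal) \<Rightarrow> 'a topology" where
  "emetric_topology M \<rho> =
     topology (\<lambda>U. U \<subseteq> M \<and> (\<forall>x\<in>U. \<exists>r>0. \<forall>y\<in>M. \<rho> x y < r \<longrightarrow> y \<in> U))"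

lemma openin_emetric_topology:
  "openin (emetric_topology M \<rho>) U \<longleftrightarrow>
     U \<subseteq> M \<and> (\<forall>x\<in>U. \<exists>r>0. \<forall>y\<in>M. \<rho> x y < r \<longrightarrow> y \<in> U)"
proof -
  let ?P = "\<lambda>U. U \<subseteq> M \<and> (\<forall>x\<in>U. \<exists>r>0. \<forall>y\<in>M. \<rho> x y < r \<longrightarrow> y \<in> U)"
  have "?P (S \<inter> U)" if S: "?P S" and U: "?P U" for S U
  proof (intro conjI ballI)
    show "S \<inter> U \<subseteq> M" using S by blast
    fix x assume x: "x \<in> S \<inter> U"
    obtain r where r: "r > 0" "\<forall>y\<in>M. \<rho> x y < r \<longrightarrow> y \<in> S" using S x by blast
    obtain s where s: "s > 0" "\<forall>y\<in>M. \<rho> x y < s \<longrightarrow> y \<in> U" using U x by blast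
    show "\<exists>r>0. \<forall>y\<in>M. \<rho> x y < r \<longrightarrow> y \<in> S \<inter> U"
      using r s by (intro exI[of _ "min r s"]) auto
  qed
  moreover have "?P (\<Union>\<K>)" if K: "\<forall>K\<in>\<K>. ?P K" for \<K>
  proof (intro conjI ballI)
    show "\<Union>\<K> \<subseteq> M" using K by blast
    fix x assume "x \<in> \<Union>\<K>"
    then obtain K where K': "K \<in> \<K>" "x \<in> K" by blast
    then obtain r where "r > 0" "\<forall>y\<in>M. \<rho> x y < r \<longrightarrow> y \<in> K" using K by blast
    then show "\<exists>r>0. \<forall>y\<in>M. \<rho> x y < r \<longrightarrow> y \<in> \<Union>\<K>" using K'(1) by blast
  qed
  ultimately have "istopology ?P" unfolding istopology_def by blast
  then show ?thesis unfolding emetric_topology_def by simp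
qed

lemma (in Metric_space) emetric_topology_ennreal:
  "emetric_topology M (\<lambda>x y. ennreal (d x y)) = mtopology"
proof -
  have key: "(\<exists>r>0. \<forall>y\<in>M. ennreal (d x y) < r \<longrightarrow> y \<in> U) \<longleftrightarrow> (\<exists>r>0. mball x r \<subseteq> U)"
    if U: "U \<subseteq> M" and x: "x \<in> U" for U x
  proof
    assume "\<exists>r>0. \<forall>y\<in>M. ennreal (d x y) < r \<longrightarrow> y \<in> U"
    then obtain r where r: "r > 0" "\<forall>y\<in>M. ennreal (d x y) < r \<longrightarrow> y \<in> U" by blast
    obtain q where q: "0 < q" "q < r" using dense[OF r(1)] by blast
    then obtain s where s: "0 < s" "ennreal s < r" by (cases q) auto
    have "mball x s \<subseteq> U"
    proof
      fix y assume y: "y \<in> mball x s"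
      then have "ennreal (d x y) < ennreal s" by (simp add: ennreal_less_iff)
      then have "ennreal (d x y) < r" using s(2) by (rule order.strict_trans)
      with r(2) y show "y \<in> U" by simp
    qed
    with s(1) show "\<exists>r>0. mball x r \<subseteq> U" by blast
  next
    assume "\<exists>r>0. mball x r \<subseteq> U"
    then obtain r where r: "r > 0" "mball x r \<subseteq> U" by blast
    have "\<forall>y\<in>M. ennreal (d x y) < ennreal r \<longrightarrow> y \<in> U"
    proof (intro ballI impI)
      fix y assume "y \<in> M" "ennreal (d x y) < ennreal r"
      then have "y \<in> mball x r" using U x by (auto simp: ennreal_less_iff)
      then show "y \<in> U" using r(2) by blast
    qed
    moreover have "ennreal r > 0" using r(1) by simp
    ultimately show "\<exists>r>0. \<forall>y\<in>M. ennreal (d x y) < r \<longrightarrow> y \<in> U" by blast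
  qed
  show ?thesis
    unfolding topology_eq openin_emetric_topology openin_mtopology using key by (meson subsetD)
qed

definition partition_of :: "real \<Rightarrow> real \<Rightarrow> nat \<Rightarrow> (nat \<Rightarrow> real) \<Rightarrow> bool" where
  "partition_of a b N t \<longleftrightarrow> t 0 = a \<and> t N = b \<and> (\<forall>i<N. t i \<le> t (Suc i))"

definition path_len :: "('a \<Rightarrow> 'a \<Rightarrow> ennreal) \<Rightarrow> real \<Rightarrow> real \<Rightarrow> (real \<Rightarrow> 'a) \<Rightarrow> ennreal" where
  "path_len \<rho> a b \<gamma> =
     Sup {(\<Sum>i<N. \<rho> (\<gamma> (t (Suc i))) (\<gamma> (t i))) | N t. partition_of a b N t}"

definition induced_intrinsic :: "'a set \<Rightarrow> ('a \<Rightarrow> 'a \<Rightarrow> ennreal) \<Rightarrow> 'a \<Rightarrow> 'a \<Rightarrow> ennreal" where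
  "induced_intrinsic M \<rho> x y =
     Inf {path_len \<rho> a b \<gamma> | a b \<gamma>. a \<le> b \<and>
            continuous_map (top_of_set {a..b}) (emetric_topology M \<rho>) \<gamma> \<and> \<gamma> a = x \<and> \<gamma> b = y}"

definition is_intrinsic :: "'a set \<Rightarrow> ('a \<Rightarrow> 'a \<Rightarrow> ennreal) \<Rightarrow> bool" where
  "is_intrinsic M \<rho> \<longleftrightarrow> (\<forall>x\<in>M. \<forall>y\<in>M. induced_intrinsic M \<rho> x y = \<rho> x y)"


section \<open>The sequence of induced Hausdorff metrics\<close>

definition hausdorff_ext :: "('a \<Rightarrow> 'a \<Rightarrow> ennreal) \<Rightarrow> 'a set \<Rightarrow> 'a set \<Rightarrow> ennreal" where
  "hausdorff_ext \<rho> A B = max (Max ((\<lambda>a. Min ((\<lambda>b. \<rho> a b) ` B)) ` A))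
                             (Max ((\<lambda>b. Min ((\<lambda>a. \<rho> a b) ` A)) ` B))"

definition translation_stabilizer :: "('a, 'b) monoid_scheme \<Rightarrow> 'a set \<Rightarrow> 'a set" where
  "translation_stabilizer G X = {g \<in> carrier G. g <#\<^bsub>G\<^esub> X = X}"

definition translate_hausdorff ::
    "('a, 'b) monoid_scheme \<Rightarrow> 'a set \<Rightarrow> ('a \<Rightarrow> 'a \<Rightarrow> ennreal) \<Rightarrow> 'a \<Rightarrow> 'a \<Rightarrow> ennreal" where
  "translate_hausdorff G X \<rho> g h = hausdorff_ext \<rho> (g <#\<^bsub>G\<^esub> X) (h <#\<^bsub>G\<^esub> X)"

primrec induced_hausdorff_seq ::
    "('a, 'b) monoid_scheme \<Rightarrow> 'a set \<Rightarrow> ('a \<Rightarrow> 'a \<Rightarrow> ennreal) \<Rightarrow> nat \<Rightarrow> 'a \<Rightarrow> 'a \<Rightarrow> ennreal" where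
  "induced_hausdorff_seq G X \<rho> 0 = \<rho>"
| "induced_hausdorff_seq G X \<rho> (Suc i) =
     induced_intrinsic (carrier G) (translate_hausdorff G X (induced_hausdorff_seq G X \<rho> i))"

definition right_invariant :: "('a, 'b) monoid_scheme \<Rightarrow> ('a \<Rightarrow> 'a \<Rightarrow> real) \<Rightarrow> bool" where
  "right_invariant G \<rho> \<longleftrightarrow> (\<forall>x\<in>carrier G. \<forall>y\<in>carrier G. \<forall>\<sigma>\<in>carrier G.
     \<rho> (x \<otimes>\<^bsub>G\<^esub> \<sigma>) (y \<otimes>\<^bsub>G\<^esub> \<sigma>) = \<rho> x y)"

end

theory Submission
  imports Defs
begin

text \<open>
  Right invariance gives \<open>\<rho>\<^sub>X \<le> D\<close> whenever \<open>\<rho> \<le> D\<close>, and passing to intrinsic metrics preserves this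
  because \<open>D\<close> is intrinsic.  Conversely, let \<open>\<rho>\<close> be an extended pseudometric whose topology is finer
  than the topology of \<open>G\<close>.  If \<open>\<rho>\<^sub>X(g, h)\<close> is small, then every \<open>hx\<close> with \<open>x \<in> X\<close> is close to a point
  of \<open>gX\<close>, in particular \<open>h\<close> is close to some \<open>k \<in> gX\<close>; continuity of the right translations forces
  \<open>kX \<subseteq> gX\<close>, so \<open>k = g\<close> because \<open>X\<close> has trivial stabilizer, and therefore \<open>\<rho>(g, h) \<le> \<rho>\<^sub>X(g, h)\<close>.
  Summing this local inequality along paths shows that \<open>\<rho>\<close> is at most the intrinsic metric of \<open>\<rho>\<^sub>X\<close>.
  Hence the topology of the latter is again finer than that of \<open>G\<close>, the sequence \<open>d\<^sup>i\<close> is increasing and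
  bounded by \<open>D\<close>, and its limit is a metric because it dominates \<open>d\<close>.  In this way the topology
  of \<open>D\<close> never has to be compared with that of \<open>G\<close>.
\<close>

section \<open>Extended pseudometrics and their topologies\<close>

definition ext_pseudometric :: "'a set \<Rightarrow> ('a \<Rightarrow> 'a \<Rightarrow> ennreal) \<Rightarrow> bool" where
  "ext_pseudometric M \<rho> \<longleftrightarrow>
     (\<forall>x\<in>M. \<rho> x x = 0) \<and> (\<forall>x\<in>M. \<forall>y\<in>M. \<rho> x y = \<rho> y x) \<and>
     (\<forall>x\<in>M. \<forall>y\<in>M. \<forall>z\<in>M. \<rho> x z \<le> \<rho> x y + \<rho> y z)"

lemma ext_pseudometricD:
  assumes "ext_pseudometric M \<rho>"
  shows "x \<in> M \<Longrightarrow> \<rho> x x = 0"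
    and "x \<in> M \<Longrightarrow> y \<in> M \<Longrightarrow> \<rho> x y = \<rho> y x"
    and "x \<in> M \<Longrightarrow> y \<in> M \<Longrightarrow> z \<in> M \<Longrightarrow> \<rho> x z \<le> \<rho> x y + \<rho> y z"
  using assms unfolding ext_pseudometric_def by blast+

lemma (in Metric_space) ext_pseudometric_ennreal:
  "ext_pseudometric M (\<lambda>x y. ennreal (d x y))"
proof -
  have "ennreal (d x z) \<le> ennreal (d x y) + ennreal (d y z)" if "x \<in> M" "y \<in> M" "z \<in> M" for x y z
    using triangle[OF that] by (simp flip: ennreal_plus)
  then show ?thesis by (auto simp: ext_pseudometric_def commute)
qed

lemma topspace_emetric_topology [simp]: "topspace (emetric_topology M \<rho>) = M"
proof
  have "openin (emetric_topology M \<rho>) M"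
    unfolding openin_emetric_topology by (auto intro: exI[of _ 1])
  then show "M \<subseteq> topspace (emetric_topology M \<rho>)" by (rule openin_subset)
  show "topspace (emetric_topology M \<rho>) \<subseteq> M"
    using openin_topspace[of "emetric_topology M \<rho>"] unfolding openin_emetric_topology by blast
qed

text \<open>Enlarging the metric shrinks the balls. This carries over continuity of paths, fineness
  along the sequence, and finally connectedness.\<close>

lemma openin_emetric_topology_mono:
  assumes le: "\<And>x y. x \<in> M \<Longrightarrow> y \<in> M \<Longrightarrow> \<rho> x y \<le> \<sigma> x y"
    and U: "openin (emetric_topology M \<rho>) U"
  shows "openin (emetric_topology M \<sigma>) U"
  using U le unfolding openin_emetric_topology by (meson order.strict_trans1 subsetD)

lemma continuous_map_emetric_topology_mono:
  assumes le: "\<And>x y. x \<in> M \<Longrightarrow> y \<in> M \<Longrightarrow> \<rho> x y \<le> \<sigma> x y"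
    and f: "continuous_map S (emetric_topology M \<sigma>) f"
  shows "continuous_map S (emetric_topology M \<rho>) f"
  using f openin_emetric_topology_mono[of M \<rho> \<sigma>, OF le] unfolding continuous_map by simp

lemma openin_emetric_ball:
  assumes \<rho>: "ext_pseudometric M \<rho>" and g: "g \<in> M"
  shows "openin (emetric_topology M \<rho>) {h \<in> M. \<rho> g h < r}"
  unfolding openin_emetric_topology
proof (intro conjI ballI)
  fix h assume h: "h \<in> {h \<in> M. \<rho> g h < r}"
  then have fin: "\<rho> g h < \<infinity>" using less_le_trans[of _ r \<infinity>] by simp
  have "\<rho> g y < r" if y: "y \<in> M" "\<rho> h y < r - \<rho> g h" for y
  proof -
    have "\<rho> h y + \<rho> g h < r" using y fin by (simp add: less_diff_eq_ennreal infinity_ennreal_def)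
    with ext_pseudometricD(3)[OF \<rho> g _ y(1), of h] h show ?thesis
      by (simp add: add.commute)
  qed
  moreover have "r - \<rho> g h > 0" using h by (simp add: diff_gr0_ennreal)
  ultimately show "\<exists>s>0. \<forall>y\<in>M. \<rho> h y < s \<longrightarrow> y \<in> {h \<in> M. \<rho> g h < r}" by blast
qed auto

section \<open>Lengths of paths\<close>

lemma path_len_upper:
  "partition_of a b N t \<Longrightarrow> (\<Sum>i<N. \<rho> (\<gamma> (t (Suc i))) (\<gamma> (t i))) \<le> path_len \<rho> a b \<gamma>"
  unfolding path_len_def by (rule Sup_upper) blast

lemma path_len_least:
  assumes "\<And>N t. partition_of a b N t \<Longrightarrow> (\<Sum>i<N. \<rho> (\<gamma> (t (Suc i))) (\<gamma> (t i))) \<le> L"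
  shows "path_len \<rho> a b \<gamma> \<le> L"
  unfolding path_len_def using assms by (auto intro: Sup_least)

lemma partition_of_mem:
  assumes "partition_of a b N t" and "i \<le> N"
  shows "t i \<in> {a..b}"
proof -
  \<comment> \<open>\<open>partition_of\<close> constrains \<open>t\<close> only up to
    \<open>N\<close>; clipping the index by \<open>min\<close> gives a sequence that is monotone on
    all naturals.\<close>
  have "t (min j N) \<le> t (min (Suc j) N)" for j
    using assms(1) by (cases "j < N") (auto simp: partition_of_def)
  from lift_Suc_mono_le[of "\<lambda>j. t (min j N)", OF this, of 0 i]
    lift_Suc_mono_le[of "\<lambda>j. t (min j N)", OF this, of i N]
  show ?thesis using assms by (simp add: partition_of_def)
qed

lemma path_len_mono:
  assumes "\<And>x y. x \<in> M \<Longrightarrow> y \<in> M \<Longrightarrow> \<rho> x y \<le> \<sigma> x y" and "\<And>s. s \<in> {a..b} \<Longrightarrow> \<gamma> s \<in> M"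
  shows "path_len \<rho> a b \<gamma> \<le> path_len \<sigma> a b \<gamma>"
proof (rule path_len_least)
  fix N t assume t: "partition_of a b N t"
  have "(\<Sum>i<N. \<rho> (\<gamma> (t (Suc i))) (\<gamma> (t i))) \<le> (\<Sum>i<N. \<sigma> (\<gamma> (t (Suc i))) (\<gamma> (t i)))"
    by (intro sum_mono assms partition_of_mem[OF t]) auto
  also have "\<dots> \<le> path_len \<sigma> a b \<gamma>" using t by (rule path_len_upper)
  finally show "(\<Sum>i<N. \<rho> (\<gamma> (t (Suc i))) (\<gamma> (t i))) \<le> path_len \<sigma> a b \<gamma>" .
qed

lemma path_len_cong:
  assumes "\<And>s. s \<in> {a..b} \<Longrightarrow> \<gamma> s = \<delta> s"
  shows "path_len \<rho> a b \<gamma> = path_len \<rho> a b \<delta>"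
proof -
  have "(\<Sum>i<N. \<rho> (\<gamma> (t (Suc i))) (\<gamma> (t i))) = (\<Sum>i<N. \<rho> (\<delta> (t (Suc i))) (\<delta> (t i)))"
    if "partition_of a b N t" for N t
    using partition_of_mem[OF that] by (intro sum.cong) (auto simp: assms)
  then show ?thesis
    unfolding path_len_def by (intro arg_cong[of _ _ Sup]) (auto, metis)
qed

text \<open>Cutting a partition of \<open>{a..c}\<close> at \<open>b\<close> by \<open>min\<close> and \<open>max\<close> keeps the number of steps, so that the
  sums can be compared term by term.\<close>

lemma path_len_split_le:
  assumes \<rho>: "ext_pseudometric M \<rho>" and ab: "a \<le> b" and bc: "b \<le> c"
    and \<gamma>: "\<And>s. s \<in> {a..c} \<Longrightarrow> \<gamma> s \<in> M"
  shows "path_len \<rho> a c \<gamma> \<le> path_len \<rho> a b \<gamma> + path_len \<rho> b c \<gamma>"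
proof (rule path_len_least)
  fix N t assume t: "partition_of a c N t"
  define u v where "u = (\<lambda>i. min (t i) b)" and "v = (\<lambda>i. max (t i) b)"
  have u: "partition_of a b N u" and v: "partition_of b c N v"
    using t ab bc by (auto simp: partition_of_def u_def v_def intro: min.coboundedI1 max.coboundedI2)
  have "\<rho> (\<gamma> (t (Suc i))) (\<gamma> (t i)) \<le>
      \<rho> (\<gamma> (u (Suc i))) (\<gamma> (u i)) + \<rho> (\<gamma> (v (Suc i))) (\<gamma> (v i))" if i: "i < N" for i
  proof -
    have M: "\<gamma> (t i) \<in> M" "\<gamma> (t (Suc i)) \<in> M" "\<gamma> b \<in> M"
      using partition_of_mem[OF t] i ab bc by (auto intro!: \<gamma>)
    have le: "t i \<le> t (Suc i)" using t i by (simp add: partition_of_def)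
    consider "t (Suc i) \<le> b" | "t i \<ge> b" | "t i < b" "b < t (Suc i)" by linarith
    then show ?thesis
    proof cases
      \<comment> \<open>Only a step that jumps over \<open>b\<close> needs the triangle inequality;
        in any other step \<open>u\<close> or \<open>v\<close> repeats the step of \<open>t\<close>
        unchanged.\<close>
      case 3
      then show ?thesis
        using ext_pseudometricD(3)[OF \<rho> M(2) M(3) M(1)] by (simp add: u_def v_def add.commute)
    qed (use le in \<open>simp_all add: u_def v_def min_def max_def\<close>)
  qed
  then have "(\<Sum>i<N. \<rho> (\<gamma> (t (Suc i))) (\<gamma> (t i))) \<le>
      (\<Sum>i<N. \<rho> (\<gamma> (u (Suc i))) (\<gamma> (u i))) + (\<Sum>i<N. \<rho> (\<gamma> (v (Suc i))) (\<gamma> (v i)))"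
    unfolding sum.distrib[symmetric] by (intro sum_mono) auto
  also have "\<dots> \<le> path_len \<rho> a b \<gamma> + path_len \<rho> b c \<gamma>"
    by (intro add_mono path_len_upper u v)
  finally show "(\<Sum>i<N. \<rho> (\<gamma> (t (Suc i))) (\<gamma> (t i))) \<le> path_len \<rho> a b \<gamma> + path_len \<rho> b c \<gamma>" .
qed

lemma partition_of_append:
  assumes t: "partition_of a b N t" and u: "partition_of b c K u"
  obtains v where "partition_of a c (N + K) v"
    and "(\<Sum>i<N + K. \<rho> (\<gamma> (v (Suc i))) (\<gamma> (v i))) =
      (\<Sum>i<N. \<rho> (\<gamma> (t (Suc i))) (\<gamma> (t i))) + (\<Sum>i<K. \<rho> (\<gamma> (u (Suc i))) (\<gamma> (u i)))"
proof
  define v where "v = (\<lambda>i. if i \<le> N then t i else u (i - N))"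
  have v1: "v i = t i" if "i \<le> N" for i using that by (simp add: v_def)
  \<comment> \<open>At \<open>i = 0\<close> the definition of \<open>v\<close> takes the branch of
    \<open>t\<close>, which is harmless because \<open>t N = b = u 0\<close>.\<close>
  have v2: "v (N + i) = u i" for i using t u by (cases i) (auto simp: v_def partition_of_def)
  show "partition_of a c (N + K) v"
    unfolding partition_of_def
  proof (intro conjI allI impI)
    show "v 0 = a" "v (N + K) = c" using t u by (simp_all add: v1 v2 partition_of_def)
    fix i assume i: "i < N + K"
    show "v i \<le> v (Suc i)"
    proof (cases "i < N")
      case True
      then show ?thesis using t by (simp add: v1 partition_of_def)
    next
      case False
      then obtain j where "i = N + j" by (metis le_Suc_ex not_less)
      then show ?thesis using u i v2[of j] v2[of "Suc j"] by (simp add: partition_of_def)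
    qed
  qed
  have "(\<Sum>i<N + K. \<rho> (\<gamma> (v (Suc i))) (\<gamma> (v i))) =
      (\<Sum>i<N. \<rho> (\<gamma> (v (Suc i))) (\<gamma> (v i))) +
      (\<Sum>i<K. \<rho> (\<gamma> (v (N + Suc i))) (\<gamma> (v (N + i))))"
    by (induction K) (simp_all add: add.assoc)
  then show "(\<Sum>i<N + K. \<rho> (\<gamma> (v (Suc i))) (\<gamma> (v i))) =
      (\<Sum>i<N. \<rho> (\<gamma> (t (Suc i))) (\<gamma> (t i))) + (\<Sum>i<K. \<rho> (\<gamma> (u (Suc i))) (\<gamma> (u i)))"
    by (simp add: v1 v2 del: add_Suc_right)
qed

lemma path_len_shift_le:
  "path_len \<rho> (a + r) (b + r) (\<lambda>s. \<gamma> (s - r)) \<le> path_len \<rho> a b \<gamma>"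
proof (rule path_len_least)
  fix N t assume "partition_of (a + r) (b + r) N t"
  then have "partition_of a b N (\<lambda>i. t i - r)" by (auto simp: partition_of_def)
  then show "(\<Sum>i<N. \<rho> (\<gamma> (t (Suc i) - r)) (\<gamma> (t i - r))) \<le> path_len \<rho> a b \<gamma>"
    by (rule path_len_upper)
qed

lemma path_len_reverse_le:
  assumes \<rho>: "ext_pseudometric M \<rho>" and \<gamma>: "\<And>s. s \<in> {a..b} \<Longrightarrow> \<gamma> s \<in> M"
  shows "path_len \<rho> (- b) (- a) (\<lambda>s. \<gamma> (- s)) \<le> path_len \<rho> a b \<gamma>"
proof (rule path_len_least)
  fix N t assume t: "partition_of (- b) (- a) N t"
  \<comment> \<open>Reversal sends step \<open>i\<close> to step \<open>N - Suc i\<close> and swaps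
    the arguments in each summand; symmetry of \<open>\<rho>\<close> swaps them back.\<close>
  define u where "u = (\<lambda>i. - t (N - i))"
  have u: "partition_of a b N u"
    unfolding partition_of_def
  proof (intro conjI allI impI)
    fix i assume "i < N"
    then have "t (N - Suc i) \<le> t (Suc (N - Suc i))" using t by (auto simp: partition_of_def)
    with \<open>i < N\<close> show "u i \<le> u (Suc i)" by (simp add: u_def Suc_diff_Suc)
  qed (use t in \<open>auto simp: partition_of_def u_def\<close>)
  have "(\<Sum>i<N. \<rho> (\<gamma> (- t (Suc i))) (\<gamma> (- t i)))
      = (\<Sum>i<N. \<rho> (\<gamma> (- t (Suc (N - Suc i)))) (\<gamma> (- t (N - Suc i))))"
    by (rule sum.nat_diff_reindex[symmetric])
  also have "\<dots> = (\<Sum>i<N. \<rho> (\<gamma> (u (Suc i))) (\<gamma> (u i)))"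
  proof (rule sum.cong)
    fix i assume "i \<in> {..<N}"
    then show "\<rho> (\<gamma> (- t (Suc (N - Suc i)))) (\<gamma> (- t (N - Suc i))) = \<rho> (\<gamma> (u (Suc i))) (\<gamma> (u i))"
      using ext_pseudometricD(2)[OF \<rho> \<gamma> \<gamma>, OF partition_of_mem partition_of_mem, OF u _ u, of i "Suc i"]
      by (simp add: u_def Suc_diff_Suc)
  qed simp
  also have "\<dots> \<le> path_len \<rho> a b \<gamma>" using u by (rule path_len_upper)
  finally show "(\<Sum>i<N. \<rho> (\<gamma> (- t (Suc i))) (\<gamma> (- t i))) \<le> path_len \<rho> a b \<gamma>" .
qed

section \<open>The induced intrinsic metric\<close>

lemma induced_intrinsic_le:
  assumes "a \<le> b" "continuous_map (top_of_set {a..b}) (emetric_topology M \<rho>) \<gamma>" "\<gamma> a = x" "\<gamma> b = y"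
  shows "induced_intrinsic M \<rho> x y \<le> path_len \<rho> a b \<gamma>"
  unfolding induced_intrinsic_def using assms by (intro Inf_lower) blast

lemma induced_intrinsic_ge:
  assumes "\<And>a b \<gamma>. \<lbrakk>a \<le> b; continuous_map (top_of_set {a..b}) (emetric_topology M \<rho>) \<gamma>;
      \<gamma> a = x; \<gamma> b = y\<rbrakk> \<Longrightarrow> L \<le> path_len \<rho> a b \<gamma>"
  shows "L \<le> induced_intrinsic M \<rho> x y"
  unfolding induced_intrinsic_def using assms by (auto intro: Inf_greatest)

text \<open>Takes the infimum in one summand while the other stays fixed, by moving \<open>c\<close>
  to the left. Subtraction in \<open>ennreal\<close> allows this only for finite \<open>c\<close>;
  the infinite case is trivial.\<close>

lemma le_induced_intrinsic_add:
  assumes "\<And>a b \<gamma>. \<lbrakk>a \<le> b; continuous_map (top_of_set {a..b}) (emetric_topology M \<rho>) \<gamma>;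
      \<gamma> a = x; \<gamma> b = y\<rbrakk> \<Longrightarrow> L \<le> path_len \<rho> a b \<gamma> + c"
  shows "L \<le> induced_intrinsic M \<rho> x y + c"
proof (cases "c = \<infinity>")
  case False
  have "L - c \<le> induced_intrinsic M \<rho> x y"
    using assms False
    by (intro induced_intrinsic_ge) (simp add: ennreal_minus_le_iff add.commute infinity_ennreal_def)
  then show ?thesis using False by (simp add: ennreal_minus_le_iff add.commute infinity_ennreal_def)
qed simp

text \<open>Every path that competes for \<open>\<sigma>\<close> also competes for
  \<open>\<rho>\<close>, since the topology of \<open>\<rho>\<close> is coarser, and its
  \<open>\<rho>\<close>-length is no greater.\<close>

lemma induced_intrinsic_mono:
  assumes le: "\<And>x y. x \<in> M \<Longrightarrow> y \<in> M \<Longrightarrow> \<rho> x y \<le> \<sigma> x y"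
  shows "induced_intrinsic M \<rho> x y \<le> induced_intrinsic M \<sigma> x y"
proof (rule induced_intrinsic_ge)
  fix a b :: real and \<gamma> assume \<gamma>: "a \<le> b" "continuous_map (top_of_set {a..b}) (emetric_topology M \<sigma>) \<gamma>"
    "\<gamma> a = x" "\<gamma> b = y"
  have "induced_intrinsic M \<rho> x y \<le> path_len \<rho> a b \<gamma>"
    using \<gamma> continuous_map_emetric_topology_mono[OF le] by (intro induced_intrinsic_le) auto
  also have "\<dots> \<le> path_len \<sigma> a b \<gamma>"
    using \<gamma>(2) by (intro path_len_mono[OF le]) (auto simp: continuous_map_def)
  finally show "induced_intrinsic M \<rho> x y \<le> path_len \<sigma> a b \<gamma>" .
qed

lemma induced_intrinsic_refl:
  assumes \<rho>: "ext_pseudometric M \<rho>" and x: "x \<in> M"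
  shows "induced_intrinsic M \<rho> x x = 0"
proof -
  have "induced_intrinsic M \<rho> x x \<le> path_len \<rho> 0 0 (\<lambda>_. x)"
    using x by (intro induced_intrinsic_le) auto
  also have "\<dots> \<le> 0"
    using ext_pseudometricD(1)[OF \<rho> x] by (intro path_len_least) simp
  finally show ?thesis by simp
qed

lemma induced_intrinsic_commute_le:
  assumes \<rho>: "ext_pseudometric M \<rho>"
  shows "induced_intrinsic M \<rho> y x \<le> induced_intrinsic M \<rho> x y"
proof (rule induced_intrinsic_ge)
  fix a b :: real and \<gamma> assume \<gamma>: "a \<le> b" "continuous_map (top_of_set {a..b}) (emetric_topology M \<rho>) \<gamma>"
    "\<gamma> a = x" "\<gamma> b = y"
  have "continuous_map (top_of_set {- b..- a}) (top_of_set {a..b}) uminus"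
    by (auto intro!: continuous_intros)
  from continuous_map_compose[OF this \<gamma>(2)]
  have "induced_intrinsic M \<rho> y x \<le> path_len \<rho> (- b) (- a) (\<lambda>s. \<gamma> (- s))"
    using \<gamma> by (intro induced_intrinsic_le) (auto simp: o_def)
  also have "\<dots> \<le> path_len \<rho> a b \<gamma>"
    using \<gamma>(2) by (intro path_len_reverse_le[OF \<rho>]) (auto simp: continuous_map_def)
  finally show "induced_intrinsic M \<rho> y x \<le> path_len \<rho> a b \<gamma>" .
qed

lemma induced_intrinsic_triangle:
  assumes \<rho>: "ext_pseudometric M \<rho>"
  shows "induced_intrinsic M \<rho> x z \<le> induced_intrinsic M \<rho> x y + induced_intrinsic M \<rho> y z"
proof -
  have join: "induced_intrinsic M \<rho> x z \<le> path_len \<rho> a b \<gamma> + path_len \<rho> a' b' \<gamma>'"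
    if \<gamma>: "a \<le> b" "continuous_map (top_of_set {a..b}) (emetric_topology M \<rho>) \<gamma>" "\<gamma> a = x" "\<gamma> b = y"
      and \<gamma>': "a' \<le> b'" "continuous_map (top_of_set {a'..b'}) (emetric_topology M \<rho>) \<gamma>'"
      "\<gamma>' a' = y" "\<gamma>' b' = z" for a b \<gamma> a' b' \<gamma>'
  proof -
    \<comment> \<open>The shift by \<open>r\<close> lets the second path start at time
      \<open>b\<close>, when the first one ends.\<close>
    define r where "r = b - a'"
    define \<delta> where "\<delta> = (\<lambda>s. if s \<le> b then \<gamma> s else \<gamma>' (s - r))"
    have "continuous_map (top_of_set {b..b' + r}) (top_of_set {a'..b'}) (\<lambda>s. s - r)"
      by (auto intro!: continuous_intros simp: r_def)
    from continuous_map_compose[OF this \<gamma>'(2)]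
    have c': "continuous_map (top_of_set {b..b' + r}) (emetric_topology M \<rho>) (\<lambda>s. \<gamma>' (s - r))"
      by (simp add: o_def)
    have c: "continuous_map (top_of_set {a..b' + r}) (emetric_topology M \<rho>) \<delta>"
      unfolding \<delta>_def
    proof (rule continuous_map_cases_le)
      have "{s \<in> {a..b' + r}. s \<in> {a..b' + r} \<and> s \<le> b} = {a..b}"
        "{s \<in> {a..b' + r}. s \<in> {a..b' + r} \<and> b \<le> s} = {b..b' + r}"
        using \<gamma>(1) \<gamma>'(1) by (auto simp: r_def)
      then show "continuous_map (subtopology (top_of_set {a..b' + r})
            {s \<in> topspace (top_of_set {a..b' + r}). s \<le> b}) (emetric_topology M \<rho>) \<gamma>"
        and "continuous_map (subtopology (top_of_set {a..b' + r})
            {s \<in> topspace (top_of_set {a..b' + r}). b \<le> s}) (emetric_topology M \<rho>) (\<lambda>s. \<gamma>' (s - r))"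
        using \<gamma>(2) c' by (simp_all add: subtopology_subtopology Int_def)
    qed (use \<gamma>(4) \<gamma>'(3) in \<open>auto simp: r_def\<close>)
    have "induced_intrinsic M \<rho> x z \<le> path_len \<rho> a (b' + r) \<delta>"
      using \<gamma> \<gamma>' c by (intro induced_intrinsic_le) (auto simp: \<delta>_def r_def)
    also have "\<dots> \<le> path_len \<rho> a b \<delta> + path_len \<rho> b (b' + r) \<delta>"
      using \<gamma>(1) \<gamma>'(1) c by (intro path_len_split_le[OF \<rho>]) (auto simp: r_def continuous_map_def)
    also have "path_len \<rho> a b \<delta> = path_len \<rho> a b \<gamma>"
      by (rule path_len_cong) (simp add: \<delta>_def)
    \<comment> \<open>At \<open>s = b\<close> the path \<open>\<delta>\<close> follows
      \<open>\<gamma>\<close>; the two branches agree there because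
      \<open>\<gamma> b = y = \<gamma>' a'\<close>.\<close>
    also have "path_len \<rho> b (b' + r) \<delta> = path_len \<rho> (a' + r) (b' + r) (\<lambda>s. \<gamma>' (s - r))"
      using \<gamma>(4) \<gamma>'(3) by (auto simp: r_def \<delta>_def intro!: path_len_cong)
    also have "\<dots> \<le> path_len \<rho> a' b' \<gamma>'" by (rule path_len_shift_le)
    finally show ?thesis by (simp add: add_left_mono)
  qed
  show ?thesis
  proof (rule le_induced_intrinsic_add)
    fix a b :: real and \<gamma> assume "a \<le> b" "continuous_map (top_of_set {a..b}) (emetric_topology M \<rho>) \<gamma>"
      "\<gamma> a = x" "\<gamma> b = y"
    \<comment> \<open>The infima are taken one after the other: here over the second path with the
      first one fixed, then over the first.\<close>
    then have "induced_intrinsic M \<rho> x z \<le> induced_intrinsic M \<rho> y z + path_len \<rho> a b \<gamma>"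
      using join by (intro le_induced_intrinsic_add) (subst add.commute, blast)
    then show "induced_intrinsic M \<rho> x z \<le> path_len \<rho> a b \<gamma> + induced_intrinsic M \<rho> y z"
      by (simp add: add.commute)
  qed
qed

lemma ext_pseudometric_induced_intrinsic:
  assumes "ext_pseudometric M \<rho>"
  shows "ext_pseudometric M (induced_intrinsic M \<rho>)"
  unfolding ext_pseudometric_def
  using assms by (auto intro: induced_intrinsic_refl induced_intrinsic_triangle
      induced_intrinsic_commute_le antisym)

section \<open>Hausdorff distances of translates\<close>

text \<open>Extrema over finite nonempty sets are attained. Taking the Hausdorff distance itself for
  \<open>r\<close> therefore yields near points realising the bound, which is how it is mostly
  applied.\<close>

lemma hausdorff_ext_le_iff:
  assumes "finite A" "A \<noteq> {}" "finite B" "B \<noteq> {}"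
  shows "hausdorff_ext \<rho> A B \<le> r \<longleftrightarrow> (\<forall>a\<in>A. \<exists>b\<in>B. \<rho> a b \<le> r) \<and> (\<forall>b\<in>B. \<exists>a\<in>A. \<rho> a b \<le> r)"
  using assms by (simp add: hausdorff_ext_def Min_le_iff)

lemma ext_pseudometric_translate_hausdorff:
  assumes G: "group G" and X: "finite X" "X \<noteq> {}" "X \<subseteq> carrier G"
    and \<rho>: "ext_pseudometric (carrier G) \<rho>"
  shows "ext_pseudometric (carrier G) (translate_hausdorff G X \<rho>)"
proof -
  interpret group G by (rule G)
  let ?H = "translate_hausdorff G X \<rho>"
  have coset: "finite (g <#\<^bsub>G\<^esub> X)" "g <#\<^bsub>G\<^esub> X \<noteq> {}" for g
    using X by (auto simp: l_coset_def)
  have sub: "g <#\<^bsub>G\<^esub> X \<subseteq> carrier G" if "g \<in> carrier G" for g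
    using that X(3) by (rule l_coset_subset_G[rotated])
  note le_iff = hausdorff_ext_le_iff[OF coset coset, folded translate_hausdorff_def]
  have comm: "?H y x \<le> ?H x y" if "x \<in> carrier G" "y \<in> carrier G" for x y
  proof -
    \<comment> \<open>Trivial as it stands, but rewriting it with \<open>le_iff\<close> produces the
      near points.\<close>
    have xy: "?H x y \<le> ?H x y" by simp
    have "\<rho> b a = \<rho> a b" if "a \<in> x <#\<^bsub>G\<^esub> X" "b \<in> y <#\<^bsub>G\<^esub> X" for a b
      using ext_pseudometricD(2)[OF \<rho>, of b a] that sub \<open>x \<in> carrier G\<close> \<open>y \<in> carrier G\<close> by blast
    then show ?thesis
      using xy[unfolded le_iff] unfolding le_iff by metis
  qed
  have tri: "?H x z \<le> ?H x y + ?H y z"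
    if x: "x \<in> carrier G" and y: "y \<in> carrier G" and z: "z \<in> carrier G" for x y z
  proof -
    have xy: "?H x y \<le> ?H x y" and yz: "?H y z \<le> ?H y z" by simp_all
    have "\<rho> a c \<le> ?H x y + ?H y z" if "a \<in> x <#\<^bsub>G\<^esub> X" "b \<in> y <#\<^bsub>G\<^esub> X" "c \<in> z <#\<^bsub>G\<^esub> X"
      "\<rho> a b \<le> ?H x y" "\<rho> b c \<le> ?H y z" for a b c
      using ext_pseudometricD(3)[OF \<rho>, of a b c] that sub[OF x] sub[OF y] sub[OF z]
      by (meson add_mono order_trans subsetD)
    then show ?thesis
      using xy[unfolded le_iff] yz[unfolded le_iff] unfolding le_iff by meson
  qed
  have "?H x x \<le> 0" if "x \<in> carrier G" for x
    unfolding le_iff using sub[OF that] ext_pseudometricD(1)[OF \<rho>] by (metis order_refl subsetD)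
  with comm tri show ?thesis by (auto simp: ext_pseudometric_def intro: antisym)
qed

text \<open>Pairing \<open>gx\<close> with \<open>hx\<close> for the same \<open>x\<close> in
  \<open>X\<close> serves both halves of the Hausdorff distance, since right invariance gives
  \<open>D(gx, hx) = D(g, h)\<close>.\<close>

lemma translate_hausdorff_le_right_invariant:
  assumes G: "group G" and X: "finite X" "X \<noteq> {}" "X \<subseteq> carrier G"
    and D: "right_invariant G D"
    and le: "\<And>x y. x \<in> carrier G \<Longrightarrow> y \<in> carrier G \<Longrightarrow> \<rho> x y \<le> ennreal (D x y)"
    and g: "g \<in> carrier G" and h: "h \<in> carrier G"
  shows "translate_hausdorff G X \<rho> g h \<le> ennreal (D g h)"
proof -
  interpret group G by (rule G)
  have coset: "finite (g <#\<^bsub>G\<^esub> X)" "g <#\<^bsub>G\<^esub> X \<noteq> {}" for g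
    using X by (auto simp: l_coset_def)
  have "\<rho> (g \<otimes>\<^bsub>G\<^esub> x) (h \<otimes>\<^bsub>G\<^esub> x) \<le> ennreal (D g h)" if "x \<in> X" for x
  proof -
    have x: "x \<in> carrier G" using that X(3) by blast
    have "\<rho> (g \<otimes>\<^bsub>G\<^esub> x) (h \<otimes>\<^bsub>G\<^esub> x) \<le> ennreal (D (g \<otimes>\<^bsub>G\<^esub> x) (h \<otimes>\<^bsub>G\<^esub> x))"
      using g h x by (intro le) auto
    also have "D (g \<otimes>\<^bsub>G\<^esub> x) (h \<otimes>\<^bsub>G\<^esub> x) = D g h"
      using D g h x by (simp add: right_invariant_def)
    finally show ?thesis .
  qed
  then show ?thesis
    unfolding translate_hausdorff_def hausdorff_ext_le_iff[OF coset coset]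
    by (fastforce simp: l_coset_def)
qed

section \<open>Rigidity of \<open>X\<close> and the comparison of successive metrics\<close>

text \<open>Left translation is injective, so both translates have as many elements as
  \<open>X\<close> and the inclusion is an equality. Then \<open>inv g \<otimes> k\<close>
  stabilizes \<open>X\<close>.\<close>

lemma (in group) l_coset_subset_imp_eq:
  assumes X: "finite X" "X \<subseteq> carrier G" "translation_stabilizer G X = {\<one>}"
    and g: "g \<in> carrier G" and k: "k \<in> carrier G" and sub: "k <# X \<subseteq> g <# X"
  shows "k = g"
proof -
  have img: "a <# X = (\<lambda>x. a \<otimes> x) ` X" for a by (auto simp: l_coset_def)
  have "card (a <# X) = card X" if "a \<in> carrier G" for a
    unfolding img using X(2) that by (intro card_image inj_onI) (metis Units_eq Units_l_cancel subsetD)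
  then have "k <# X = g <# X"
    using sub g k X(1) by (intro card_subset_eq) (auto simp: img)
  then have "(inv g \<otimes> k) <# X = X"
    using X(2) g k by (metis inv_closed l_inv lcos_m_assoc lcos_mult_one)
  then have "inv g \<otimes> k \<in> translation_stabilizer G X"
    using g k by (simp add: translation_stabilizer_def)
  then show ?thesis
    using X(3) g k by (metis inv_equality inv_inv inv_closed singletonD)
qed

text \<open>Collects what the comparison uses of the Lie group: a Hausdorff topology with continuous
  right translations, together with the finite rigid set.\<close>

locale rigid_subset = group G for G (structure) +
  fixes T :: "'a topology" and X :: "'a set"
  assumes Hausdorff: "Hausdorff_space T"
    and topspace: "topspace T = carrier G"
    and continuous_right_mult: "x \<in> carrier G \<Longrightarrow> continuous_map T T (\<lambda>g. g \<otimes> x)"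
    and finite_X: "finite X" and X_sub: "X \<subseteq> carrier G" and one_X: "\<one> \<in> X"
    and stabilizer: "translation_stabilizer G X = {\<one>}"
begin

text \<open>The radius \<open>\<epsilon>\<close> depends on \<open>g\<close>. It lies below finitely
  many thresholds, each excluding one way in which a point \<open>k\<close> of \<open>gX\<close>
  near \<open>h\<close> could have \<open>kX\<close> not contained in \<open>gX\<close>.\<close>

lemma le_translate_hausdorff_local:
  assumes finer: "\<And>U. openin T U \<Longrightarrow> openin (emetric_topology (carrier G) \<rho>) U"
    and g: "g \<in> carrier G"
  obtains \<epsilon> where "\<epsilon> > 0"
    and "\<And>h. h \<in> carrier G \<Longrightarrow> translate_hausdorff G X \<rho> g h < \<epsilon> \<Longrightarrow>
      \<rho> g h \<le> translate_hausdorff G X \<rho> g h"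
proof -
  have coset: "finite (g <# X)" "g <# X \<noteq> {}" for g
    using finite_X one_X by (auto simp: l_coset_def)
  \<comment> \<open>The bad configurations: \<open>h\<close> near \<open>a\<close> and
    \<open>h \<otimes> x\<close> near \<open>b\<close>, although \<open>a \<otimes> x\<close>
    differs from \<open>b\<close>. Separating \<open>a \<otimes> x\<close> from \<open>b\<close> and
    pulling back along right translation by \<open>x\<close> rules each out at small scale.\<close>
  define S where "S = {(a, x, b) \<in> (g <# X) \<times> X \<times> (g <# X). a \<otimes> x \<noteq> b}"
  have fin: "finite S"
    unfolding S_def using coset finite_X
    by (intro finite_subset[OF _ finite_cartesian_product[OF coset(1)[of g]
            finite_cartesian_product[OF finite_X coset(1)[of g]]]]) auto
  have "\<exists>\<epsilon>>0. \<forall>h\<in>carrier G. \<not> (\<rho> a h < \<epsilon> \<and> \<rho> b (h \<otimes> x) < \<epsilon>)" if "(a, x, b) \<in> S" for a x b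
  proof -
    have x: "x \<in> carrier G" and a: "a \<in> carrier G" and b: "b \<in> carrier G" and ne: "a \<otimes> x \<noteq> b"
      using that X_sub g by (auto simp: S_def l_coset_def)
    obtain V W where V: "openin T V" "a \<otimes> x \<in> V" and W: "openin T W" "b \<in> W" and dis: "disjnt V W"
      using Hausdorff ne a b x unfolding Hausdorff_space_def topspace by (meson m_closed)
    have "openin T {h \<in> carrier G. h \<otimes> x \<in> V}"
      using openin_continuous_map_preimage[OF continuous_right_mult[OF x] V(1)] by (simp add: topspace)
    then have "openin (emetric_topology (carrier G) \<rho>) {h \<in> carrier G. h \<otimes> x \<in> V}" by (rule finer)
    then obtain r where r: "r > 0" "\<forall>h\<in>carrier G. \<rho> a h < r \<longrightarrow> h \<otimes> x \<in> V"
      using a V(2) unfolding openin_emetric_topology by fastforce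
    from finer[OF W(1)] obtain s where s: "s > 0" "\<forall>h\<in>carrier G. \<rho> b h < s \<longrightarrow> h \<in> W"
      unfolding openin_emetric_topology using W(2) by blast
    have "\<forall>h\<in>carrier G. \<not> (\<rho> a h < min r s \<and> \<rho> b (h \<otimes> x) < min r s)"
      using r(2) s(2) dis x by (auto simp: disjnt_iff)
    then show ?thesis using r(1) s(1) by (metis min_less_iff_conj)
  qed
  then have "\<forall>p\<in>S. \<exists>\<epsilon>>0. \<forall>h\<in>carrier G. \<not> (\<rho> (fst p) h < \<epsilon> \<and> \<rho> (snd (snd p)) (h \<otimes> fst (snd p)) < \<epsilon>)"
    by fastforce
  then obtain e where e: "\<And>p. p \<in> S \<Longrightarrow> e p > (0::ennreal)"
    "\<And>p h. \<lbrakk>p \<in> S; h \<in> carrier G\<rbrakk> \<Longrightarrow> \<not> (\<rho> (fst p) h < e p \<and> \<rho> (snd (snd p)) (h \<otimes> fst (snd p)) < e p)"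
    by metis
  \<comment> \<open>The extra element 1 keeps the minimum meaningful when \<open>S\<close> is
    empty.\<close>
  define \<epsilon> where "\<epsilon> = Min (insert 1 (e ` S))"
  show thesis
  proof
    show "\<epsilon> > 0" unfolding \<epsilon>_def using fin e(1) by (subst Min_gr_iff) auto
    fix h assume h: "h \<in> carrier G" and small: "translate_hausdorff G X \<rho> g h < \<epsilon>"
    have near: "\<exists>b \<in> g <# X. \<rho> b (h \<otimes> x) \<le> translate_hausdorff G X \<rho> g h" if "x \<in> X" for x
      using that hausdorff_ext_le_iff[OF coset coset, of \<rho> g h "translate_hausdorff G X \<rho> g h"]
      by (fastforce simp: translate_hausdorff_def l_coset_def)
    \<comment> \<open>This is where the identity belongs to \<open>X\<close>: \<open>h\<close>
      itself is a point of \<open>hX\<close>.\<close>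
    obtain k where k: "k \<in> g <# X" "\<rho> k h \<le> translate_hausdorff G X \<rho> g h"
      using near[OF one_X] h by auto
    have kG: "k \<in> carrier G" using k(1) l_coset_subset_G[OF X_sub g] by blast
    have "k \<otimes> x \<in> g <# X" if x: "x \<in> X" for x
    proof -
      obtain b where b: "b \<in> g <# X" "\<rho> b (h \<otimes> x) \<le> translate_hausdorff G X \<rho> g h"
        using near[OF x] by blast
      have "(k, x, b) \<notin> S"
      proof
        assume p: "(k, x, b) \<in> S"
        then have "\<epsilon> \<le> e (k, x, b)" unfolding \<epsilon>_def using fin by (intro Min_le) auto
        then show False using e(2)[OF p h] k(2) b(2) small by (auto simp: not_less)
      qed
      then show ?thesis using k(1) b(1) x by (auto simp: S_def)
    qed
    then have "k <# X \<subseteq> g <# X" by (auto simp: l_coset_def)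
    then have "k = g" using finite_X X_sub stabilizer g kG by (intro l_coset_subset_imp_eq)
    then show "\<rho> g h \<le> translate_hausdorff G X \<rho> g h" using k(2) by simp
  qed
qed

text \<open>The local inequality is summed along a path by bisection, so no uniform radius is
  required. If \<open>x\<close> or \<open>y\<close> lies outside the carrier, there is no path and
  the right-hand side is infinite.\<close>

lemma le_induced_intrinsic_translate_hausdorff:
  assumes \<rho>: "ext_pseudometric (carrier G) \<rho>"
    and finer: "\<And>U. openin T U \<Longrightarrow> openin (emetric_topology (carrier G) \<rho>) U"
  shows "\<rho> x y \<le> induced_intrinsic (carrier G) (translate_hausdorff G X \<rho>) x y"
proof (rule induced_intrinsic_ge)
  let ?H = "translate_hausdorff G X \<rho>"
  have H: "ext_pseudometric (carrier G) ?H"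
    using finite_X one_X X_sub \<rho>
    by (intro ext_pseudometric_translate_hausdorff) (auto intro: group_axioms)
  fix a b :: real and \<gamma>
  assume ab: "a \<le> b" and cont: "continuous_map (top_of_set {a..b}) (emetric_topology (carrier G) ?H) \<gamma>"
    and ends: "\<gamma> a = x" "\<gamma> b = y"
  have \<gamma>: "\<gamma> s \<in> carrier G" if "s \<in> {a..b}" for s
    using cont that by (auto simp: continuous_map_def)
  \<comment> \<open>Some partition of \<open>{u..v}\<close> already has a sum dominating the
    distance of the end points. The guard is there because the local hypothesis of
    \<open>Bolzano\<close> also ranges over intervals that leave \<open>{a..b}\<close>.\<close>
  define P where "P = (\<lambda>u v. a \<le> u \<and> v \<le> b \<longrightarrow>
    (\<exists>N t. partition_of u v N t \<and> \<rho> (\<gamma> u) (\<gamma> v) \<le> (\<Sum>i<N. ?H (\<gamma> (t (Suc i))) (\<gamma> (t i)))))"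
  have "P a b"
  proof (rule Bolzano[OF ab])
    fix u v w assume uv: "P u v" and vw: "P v w" and le: "u \<le> v" "v \<le> w"
    show "P u w"
      unfolding P_def
    proof (intro impI)
      assume uw: "a \<le> u \<and> w \<le> b"
      obtain N t where t: "partition_of u v N t"
        "\<rho> (\<gamma> u) (\<gamma> v) \<le> (\<Sum>i<N. ?H (\<gamma> (t (Suc i))) (\<gamma> (t i)))"
        using uv uw le unfolding P_def by auto
      obtain K s where s: "partition_of v w K s"
        "\<rho> (\<gamma> v) (\<gamma> w) \<le> (\<Sum>i<K. ?H (\<gamma> (s (Suc i))) (\<gamma> (s i)))"
        using vw uw le unfolding P_def by auto
      obtain r where r: "partition_of u w (N + K) r"
        "(\<Sum>i<N + K. ?H (\<gamma> (r (Suc i))) (\<gamma> (r i))) =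
          (\<Sum>i<N. ?H (\<gamma> (t (Suc i))) (\<gamma> (t i))) + (\<Sum>i<K. ?H (\<gamma> (s (Suc i))) (\<gamma> (s i)))"
        using partition_of_append[OF t(1) s(1)] by blast
      have "\<rho> (\<gamma> u) (\<gamma> w) \<le> \<rho> (\<gamma> u) (\<gamma> v) + \<rho> (\<gamma> v) (\<gamma> w)"
        using uw le by (intro ext_pseudometricD(3)[OF \<rho>] \<gamma>) auto
      also have "\<dots> \<le> (\<Sum>i<N. ?H (\<gamma> (t (Suc i))) (\<gamma> (t i))) + (\<Sum>i<K. ?H (\<gamma> (s (Suc i))) (\<gamma> (s i)))"
        using t(2) s(2) by (rule add_mono)
      finally show "\<exists>N t. partition_of u w N t \<and>
          \<rho> (\<gamma> u) (\<gamma> w) \<le> (\<Sum>i<N. ?H (\<gamma> (t (Suc i))) (\<gamma> (t i)))"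
        unfolding r(2)[symmetric] using r(1) by blast
    qed
  next
    fix c assume c: "a \<le> c" "c \<le> b"
    then have \<gamma>c: "\<gamma> c \<in> carrier G" by (intro \<gamma>) simp
    obtain \<epsilon> where \<epsilon>: "\<epsilon> > 0"
      "\<And>h. \<lbrakk>h \<in> carrier G; ?H (\<gamma> c) h < \<epsilon>\<rbrakk> \<Longrightarrow> \<rho> (\<gamma> c) h \<le> ?H (\<gamma> c) h"
      using le_translate_hausdorff_local[OF finer \<gamma>c] by metis
    have "openin (top_of_set {a..b}) {s \<in> {a..b}. \<gamma> s \<in> {h \<in> carrier G. ?H (\<gamma> c) h < \<epsilon>}}"
      using openin_continuous_map_preimage[OF cont openin_emetric_ball[OF H \<gamma>c, of \<epsilon>]] by simp
    moreover have "c \<in> {s \<in> {a..b}. \<gamma> s \<in> {h \<in> carrier G. ?H (\<gamma> c) h < \<epsilon>}}"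
      using c \<gamma>c \<epsilon>(1) ext_pseudometricD(1)[OF H \<gamma>c] by simp
    ultimately obtain \<delta> where \<delta>: "\<delta> > 0"
      "\<And>s. \<lbrakk>s \<in> {a..b}; dist s c < \<delta>\<rbrakk> \<Longrightarrow> ?H (\<gamma> c) (\<gamma> s) < \<epsilon>"
      unfolding openin_euclidean_subtopology_iff by blast
    have near: "\<rho> (\<gamma> c) (\<gamma> s) \<le> ?H (\<gamma> c) (\<gamma> s)" if "s \<in> {a..b}" "\<bar>s - c\<bar> < \<delta>" for s
      using that by (intro \<epsilon>(2) \<delta>(2) \<gamma>) (simp_all add: dist_real_def)
    have "P u v" if uv: "u \<le> c" "c \<le> v" "v - u < \<delta>" for u v
      unfolding P_def
    proof (intro impI)
      assume "a \<le> u \<and> v \<le> b"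
      then have u: "u \<in> {a..b}" and v: "v \<in> {a..b}" using uv c by auto
      \<comment> \<open>The local inequality is centred at \<open>\<gamma> c\<close>, so
        \<open>c\<close> becomes the middle point and both distances are measured from it.\<close>
      define t where "t = (\<lambda>i::nat. if i = 0 then u else if i = 1 then c else v)"
      have t: "partition_of u v 2 t"
        using uv by (auto simp: partition_of_def t_def less_2_cases_iff)
      have "\<rho> (\<gamma> u) (\<gamma> v) \<le> \<rho> (\<gamma> u) (\<gamma> c) + \<rho> (\<gamma> c) (\<gamma> v)"
        by (intro ext_pseudometricD(3)[OF \<rho>] \<gamma> u v \<gamma>c)
      also have "\<dots> = \<rho> (\<gamma> c) (\<gamma> u) + \<rho> (\<gamma> c) (\<gamma> v)"
        using ext_pseudometricD(2)[OF \<rho> \<gamma>c \<gamma>[OF u]] by simp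
      also have "\<dots> \<le> ?H (\<gamma> c) (\<gamma> u) + ?H (\<gamma> c) (\<gamma> v)"
        using uv u v by (intro add_mono near) auto
      also have "\<dots> = ?H (\<gamma> c) (\<gamma> u) + ?H (\<gamma> v) (\<gamma> c)"
        using ext_pseudometricD(2)[OF H \<gamma>c \<gamma>[OF v]] by simp
      also have "\<dots> = (\<Sum>i<2. ?H (\<gamma> (t (Suc i))) (\<gamma> (t i)))"
        by (simp add: t_def numeral_2_eq_2)
      finally show "\<exists>N t. partition_of u v N t \<and>
          \<rho> (\<gamma> u) (\<gamma> v) \<le> (\<Sum>i<N. ?H (\<gamma> (t (Suc i))) (\<gamma> (t i)))"
        using t by blast
    qed
    then show "\<exists>\<delta>>0. \<forall>u v. u \<le> c \<and> c \<le> v \<and> v - u < \<delta> \<longrightarrow> P u v" using \<delta>(1) by blast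
  qed
  then obtain N t where "partition_of a b N t"
    "\<rho> (\<gamma> a) (\<gamma> b) \<le> (\<Sum>i<N. ?H (\<gamma> (t (Suc i))) (\<gamma> (t i)))"
    unfolding P_def by auto
  then show "\<rho> x y \<le> path_len ?H a b \<gamma>"
    using path_len_upper[of a b N t ?H \<gamma>] ends by (auto intro: order_trans)
qed

text \<open>Fineness and growth feed each other: if the topology of \<open>s i\<close> is finer than
  \<open>T\<close>, then \<open>s i\<close> is at most \<open>s (Suc i)\<close>, whose topology is
  then finer than \<open>T\<close> as well.\<close>

lemma induced_hausdorff_seq_pseudometric_mono:
  assumes \<rho>: "ext_pseudometric (carrier G) \<rho>"
    and finer: "\<And>U. openin T U \<Longrightarrow> openin (emetric_topology (carrier G) \<rho>) U"
  defines "s \<equiv> induced_hausdorff_seq G X \<rho>"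
  shows "ext_pseudometric (carrier G) (s i)" and "s i x y \<le> s (Suc i) x y"
proof -
  have step: "ext_pseudometric (carrier G) (s (Suc i))" if "ext_pseudometric (carrier G) (s i)" for i
    using that finite_X one_X X_sub unfolding s_def induced_hausdorff_seq.simps
    by (intro ext_pseudometric_induced_intrinsic ext_pseudometric_translate_hausdorff)
      (auto intro: group_axioms)
  have pm: "ext_pseudometric (carrier G) (s i)" for i
    by (induction i) (use \<rho> step in \<open>auto simp: s_def\<close>)
  then show "ext_pseudometric (carrier G) (s i)" .
  have le: "s i x y \<le> s (Suc i) x y"
    if "\<And>U. openin T U \<Longrightarrow> openin (emetric_topology (carrier G) (s i)) U" for i x y
    using le_induced_intrinsic_translate_hausdorff[OF pm that] by (simp add: s_def)
  have "openin (emetric_topology (carrier G) (s i)) U" if "openin T U" for U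
    using that
  proof (induction i arbitrary: U)
    case 0
    then show ?case using finer by (simp add: s_def)
  next
    case (Suc i)
    show ?case by (rule openin_emetric_topology_mono[OF le, OF Suc.IH Suc.IH[OF Suc.prems]])
  qed
  then show "s i x y \<le> s (Suc i) x y" by (rule le)
qed

end

section \<open>The upper bound and connectedness\<close>

text \<open>The bound survives both halves of the recursion: the Hausdorff half by right invariance,
  the intrinsic half because \<open>D\<close> equals its own induced intrinsic metric.\<close>

lemma induced_hausdorff_seq_le:
  assumes G: "group G" and X: "finite X" "X \<noteq> {}" "X \<subseteq> carrier G"
    and D: "right_invariant G D" "is_intrinsic (carrier G) (\<lambda>x y. ennreal (D x y))"
    and le: "\<And>x y. x \<in> carrier G \<Longrightarrow> y \<in> carrier G \<Longrightarrow> \<rho> x y \<le> ennreal (D x y)"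
    and "x \<in> carrier G" "y \<in> carrier G"
  shows "induced_hausdorff_seq G X \<rho> i x y \<le> ennreal (D x y)"
  using assms(8,9)
proof (induction i arbitrary: x y)
  case 0
  then show ?case by (simp add: le)
next
  case (Suc i)
  have "induced_hausdorff_seq G X \<rho> (Suc i) x y \<le>
      induced_intrinsic (carrier G) (\<lambda>x y. ennreal (D x y)) x y"
    unfolding induced_hausdorff_seq.simps
    by (intro induced_intrinsic_mono translate_hausdorff_le_right_invariant G X D(1) Suc.IH)
  then show ?case using D(2) Suc.prems by (simp add: is_intrinsic_def)
qed

lemma is_intrinsic_imp_connected_space:
  assumes D: "is_intrinsic M (\<lambda>x y. ennreal (D x y))"
  shows "connected_space (emetric_topology M (\<lambda>x y. ennreal (D x y)))"
  unfolding connected_space_subconnected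
proof (intro ballI)
  let ?T = "emetric_topology M (\<lambda>x y. ennreal (D x y))"
  fix x y assume "x \<in> topspace ?T" "y \<in> topspace ?T"
  \<comment> \<open>\<open>D\<close> has finite values, so the infimum over connecting paths cannot
    be that of the empty set.\<close>
  then have "\<not> \<infinity> \<le> induced_intrinsic M (\<lambda>x y. ennreal (D x y)) x y"
    using D by (simp add: is_intrinsic_def not_le)
  then obtain a b :: real and \<gamma> where ab: "a \<le> b"
    and \<gamma>: "continuous_map (top_of_set {a..b}) ?T \<gamma>" "\<gamma> a = x" "\<gamma> b = y"
    using induced_intrinsic_ge[of M "\<lambda>x y. ennreal (D x y)" x y \<infinity>] by blast
  have "connectedin ?T (\<gamma> ` {a..b})"
    using connectedin_continuous_map_image[OF \<gamma>(1), of "{a..b}"]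
    by (simp add: connectedin_subtopology)
  then show "\<exists>S. connectedin ?T S \<and> x \<in> S \<and> y \<in> S" using ab \<gamma> by force
qed

lemma connected_space_coarser:
  assumes "connected_space T'" "topspace T = topspace T'" "\<And>U. openin T U \<Longrightarrow> openin T' U"
  shows "connected_space T"
  using assms unfolding connected_space_def by metis

section \<open>The limit metric\<close>

theorem theorem3p10:
  fixes G :: "('a, 'b) monoid_scheme" and n :: nat and T :: "'a topology" and A :: "'a chart set"
    and d D :: "'a \<Rightarrow> 'a \<Rightarrow> real" and X :: "'a set"
  assumes "lie_group G n T A"
    and "Metric_space (carrier G) d"
    and "Metric_space.mtopology (carrier G) d = T"
    and "finite X" and "X \<subseteq> carrier G" and "\<one>\<^bsub>G\<^esub> \<in> X"
    and "translation_stabilizer G X = {\<one>\<^bsub>G\<^esub>}"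
    and "Metric_space (carrier G) D"
    and "right_invariant G D"
    and "is_intrinsic (carrier G) (\<lambda>x y. ennreal (D x y))"
    and "\<forall>x\<in>carrier G. \<forall>y\<in>carrier G. d x y \<le> D x y"
  shows "connected_space T \<and>
    (\<forall>i. \<forall>x\<in>carrier G. \<forall>y\<in>carrier G.
       induced_hausdorff_seq G X (\<lambda>x y. ennreal (d x y)) i x y \<le> ennreal (D x y)) \<and>
    (\<exists>d_inf. Metric_space (carrier G) d_inf \<and>
       (\<forall>x\<in>carrier G. \<forall>y\<in>carrier G.
          (\<lambda>i. induced_hausdorff_seq G X (\<lambda>x y. ennreal (d x y)) i x y)
            \<longlonglongrightarrow> ennreal (d_inf x y)))"
proof -
  interpret lie_group G n T A by fact
  interpret d: Metric_space "carrier G" d by fact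
  have T: "emetric_topology (carrier G) (\<lambda>x y. ennreal (d x y)) = T"
    using d.emetric_topology_ennreal assms(3) by simp
  have "continuous_map T T (\<lambda>g. g \<otimes>\<^bsub>G\<^esub> x)" if "x \<in> carrier G" for x
  proof -
    have "continuous_map T (prod_topology T T) (\<lambda>g. (g, x))"
      using that topspace_eq by (auto intro!: continuous_map_pairedI)
    from continuous_map_compose[OF this] smooth_mult show ?thesis
      unfolding smooth_map_def by (fastforce simp: o_def)
  qed
  then interpret rigid_subset G T X
    using Hausdorff topspace_eq assms(4-7) by unfold_locales auto
  define s where "s = induced_hausdorff_seq G X (\<lambda>x y. ennreal (d x y))"
  have pm: "ext_pseudometric (carrier G) (s i)" and Suc_le: "s i x y \<le> s (Suc i) x y" for i x y
    unfolding s_def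
    by (rule induced_hausdorff_seq_pseudometric_mono[OF d.ext_pseudometric_ennreal]; simp add: T)+
  have dD: "ennreal (d x y) \<le> ennreal (D x y)" if "x \<in> carrier G" "y \<in> carrier G" for x y
    using assms(11) that by (simp add: ennreal_leI)
  have le: "s i x y \<le> ennreal (D x y)" if "x \<in> carrier G" "y \<in> carrier G" for i x y
    unfolding s_def using group_axioms assms(4-6,9,10) dD that
    by (intro induced_hausdorff_seq_le) auto
  define L where "L = (\<lambda>x y. SUP i. s i x y)"
  \<comment> \<open>The value 0 off the carrier makes \<open>d_inf\<close> symmetric everywhere, as
    \<open>Metric_space\<close> demands. On the carrier \<open>L\<close> is finite by the bound
    \<open>D\<close>, so \<open>enn2real\<close> loses nothing.\<close>
  define d_inf where "d_inf = (\<lambda>x y. if x \<in> carrier G \<and> y \<in> carrier G then enn2real (L x y) else 0)"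
  have lim: "(\<lambda>i. s i x y) \<longlonglongrightarrow> L x y" for x y
    unfolding L_def by (intro LIMSEQ_SUP incseq_SucI Suc_le)
  have L_le: "L x y \<le> ennreal (D x y)" if "x \<in> carrier G" "y \<in> carrier G" for x y
    unfolding L_def using le[OF that] by (intro SUP_least)
  have L_eq: "ennreal (d_inf x y) = L x y" if "x \<in> carrier G" "y \<in> carrier G" for x y
    using le_less_trans[OF L_le[OF that] ennreal_less_top] that by (simp add: d_inf_def)
  have L: "ext_pseudometric (carrier G) L"
  proof -
    have "L x z \<le> L x y + L y z" if "x \<in> carrier G" "y \<in> carrier G" "z \<in> carrier G" for x y z
      using ext_pseudometricD(3)[OF pm that] by (intro LIMSEQ_le[OF lim tendsto_add[OF lim lim]]) auto
    then show ?thesis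
      using ext_pseudometricD(1,2)[OF pm] by (auto simp: ext_pseudometric_def L_def)
  qed
  \<comment> \<open>The term of index 0 in the supremum is \<open>d\<close>; this gives separation
    of points.\<close>
  have L_ge: "ennreal (d x y) \<le> L x y" for x y
    unfolding L_def by (rule SUP_upper2[of 0]) (simp_all add: s_def)
  have "Metric_space (carrier G) d_inf"
  proof
    show nonneg: "0 \<le> d_inf x y" for x y by (simp add: d_inf_def)
    show "d_inf x y = d_inf y x" for x y
      using ext_pseudometricD(2)[OF L, of x y] by (simp add: d_inf_def)
    fix x y assume x: "x \<in> carrier G" and y: "y \<in> carrier G"
    show "d_inf x y = 0 \<longleftrightarrow> x = y"
    proof
      assume "d_inf x y = 0"
      then have "ennreal (d x y) \<le> 0" using L_ge[of x y] L_eq[OF x y] by simp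
      then show "x = y" using x y d.nonneg[of x y] by (simp add: ennreal_eq_0_iff)
    next
      assume "x = y"
      then show "d_inf x y = 0" using ext_pseudometricD(1)[OF L x] by (simp add: d_inf_def)
    qed
    fix z assume z: "z \<in> carrier G"
    have "ennreal (d_inf x z) \<le> ennreal (d_inf x y + d_inf y z)"
      using ext_pseudometricD(3)[OF L x y z] x y z nonneg by (simp add: L_eq ennreal_plus)
    then show "d_inf x z \<le> d_inf x y + d_inf y z"
      using nonneg by (simp add: ennreal_le_iff flip: ennreal_plus)
  qed
  \<comment> \<open>Since \<open>d\<close> is bounded by \<open>D\<close>, \<open>T\<close> is
    coarser than the connected topology of \<open>D\<close>.\<close>
  moreover have "connected_space T"
    using is_intrinsic_imp_connected_space[OF assms(10)]
    by (rule connected_space_coarser)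
      (use openin_emetric_topology_mono[OF dD] T topspace_eq in auto)
  ultimately show ?thesis
    using le lim L_eq unfolding s_def by auto
qed

end
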